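(* Let $\gamma$ be as in the context. There is an integer $s_0\ge N$ such that for every $s\ge s_0$, putting $R=N/(N+1)$, $P_1=\dfrac{R^{2s}}{(1-R^{s-N})^2}$ and $P_2=1-R^{s-N}$, we have $P_2\ge P_1$ and $[P_1,P_2]\subseteq\{xy: x\in E(\gamma,s),\ y\in F(\gamma,s)\}$.
   Context: $\gamma\in(0,1)$ is irrational with negative continued fraction $\gamma_1=\gamma$, $g_i=\lceil1/\gamma_i\rceil$, $\gamma_{i+1}=g_i-1/\gamma_i$, such that $(g_i)$ is bounded and contains no block of $N$ consecutive $2$'s ($N\ge1$ fixed). $D_0=1$, $D_i=\gamma_1\cdots\gamma_i$. Davenport coefficients of $x\in[0,1)$: $x_1=x$, $b_i=\lfloor x_i/\gamma_i\rfloor$, $x_{i+1}=x_i/\gamma_i-b_i$. $F(\gamma,s)$ is the set of $x\in[0,1)$ whose Davenport coefficients contain no block $b_i,\dots,b_{i+s}$ of zeros only and no block $b_i,\dots,b_{i+s}$ equal to $g_i-1,g_{i+1}-2,\dots,g_{i+s}-2$. $E(\gamma,s)$ is the set of $x\in[0,1]$ admitting a representation $x=\sum b_kD_k$ where $(b_k)$ is either the Davenport coefficient sequence of $x$ or the sequence $b_1,\dots,b_{m-1},b_m-1,g_{m+1}-1,g_{m+2}-2,g_{m+3}-2,\dots$ obtained when the Davenport coefficients are $b_1,\dots,b_m,0,0,\dots$ with $b_m\ge1$, such that $(b_k)$ has no block $b_i,\dots,b_{i+s}$ of zeros only and no block $b_i,\dots,b_{i+s}$ equal to $g_i-2,\dots,g_{i+s-1}-2,g_{i+s}-1$.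 *)

theory Defs
  imports Complex_Main
begin

text \<open>
  All sequences are indexed from 0: \<open>ncf_rem \<gamma> i\<close>, \<open>ncf_quot \<gamma> i\<close>, \<open>dav_rem \<gamma> x i\<close> and
  \<open>dav_digit \<gamma> x i\<close> are the mathematical $\gamma_{i+1}$, $g_{i+1}$, $x_{i+1}$ and $b_{i+1}$.
  The products keep their index: \<open>ncf_D \<gamma> i\<close> is $D_i = \gamma_1 \cdots \gamma_i$.
\<close>

primrec ncf_rem :: "real \<Rightarrow> nat \<Rightarrow> real" where
  "ncf_rem \<gamma> 0 = \<gamma>"
| "ncf_rem \<gamma> (Suc i) = of_int \<lceil>1 / ncf_rem \<gamma> i\<rceil> - 1 / ncf_rem \<gamma> i"

definition ncf_quot :: "real \<Rightarrow> nat \<Rightarrow> int" where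
  "ncf_quot \<gamma> i = \<lceil>1 / ncf_rem \<gamma> i\<rceil>"

definition ncf_D :: "real \<Rightarrow> nat \<Rightarrow> real" where
  "ncf_D \<gamma> i = (\<Prod>j<i. ncf_rem \<gamma> j)"

primrec dav_rem :: "real \<Rightarrow> real \<Rightarrow> nat \<Rightarrow> real" where
  "dav_rem \<gamma> x 0 = x"
| "dav_rem \<gamma> x (Suc i) =
     dav_rem \<gamma> x i / ncf_rem \<gamma> i - of_int \<lfloor>dav_rem \<gamma> x i / ncf_rem \<gamma> i\<rfloor>"

text \<open>
  The recursion is also used at \<open>x = 1\<close>, where it yields the digits
  $g_1 - 1, g_2 - 2, g_3 - 2, \ldots$
\<close>

definition dav_digit :: "real \<Rightarrow> real \<Rightarrow> nat \<Rightarrow> int" where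
  "dav_digit \<gamma> x i = \<lfloor>dav_rem \<gamma> x i / ncf_rem \<gamma> i\<rfloor>"

text \<open>All blocks below have the \<open>s + 1\<close> entries $b_i, \ldots, b_{i+s}$.\<close>

definition has_zero_block :: "nat \<Rightarrow> (nat \<Rightarrow> int) \<Rightarrow> bool" where
  "has_zero_block s b \<longleftrightarrow> (\<exists>i. \<forall>j\<le>s. b (i + j) = 0)"

definition has_F_block :: "real \<Rightarrow> nat \<Rightarrow> (nat \<Rightarrow> int) \<Rightarrow> bool" where
  "has_F_block \<gamma> s b \<longleftrightarrow>
     (\<exists>i. b i = ncf_quot \<gamma> i - 1 \<and>
          (\<forall>j. 1 \<le> j \<and> j \<le> s \<longrightarrow> b (i + j) = ncf_quot \<gamma> (i + j) - 2))"

definition has_E_block :: "real \<Rightarrow> nat \<Rightarrow> (nat \<Rightarrow> int) \<Rightarrow> bool" where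
  "has_E_block \<gamma> s b \<longleftrightarrow>
     (\<exists>i. (\<forall>j<s. b (i + j) = ncf_quot \<gamma> (i + j) - 2) \<and>
          b (i + s) = ncf_quot \<gamma> (i + s) - 1)"

definition F_set :: "real \<Rightarrow> nat \<Rightarrow> real set" where
  "F_set \<gamma> s = {x. 0 \<le> x \<and> x < 1 \<and>
     \<not> has_zero_block s (dav_digit \<gamma> x) \<and> \<not> has_F_block \<gamma> s (dav_digit \<gamma> x)}"

text \<open>
  For a digit sequence whose last nonzero entry is at position \<open>m\<close>, this is the other
  representation of the same number, ending in
  $b_m - 1, g_{m+1} - 1, g_{m+2} - 2, g_{m+3} - 2, \ldots$
\<close>

definition alt_digits :: "real \<Rightarrow> (nat \<Rightarrow> int) \<Rightarrow> nat \<Rightarrow> nat \<Rightarrow> int" where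
  "alt_digits \<gamma> b m k =
     (if k < m then b k
      else if k = m then b m - 1
      else if k = m + 1 then ncf_quot \<gamma> k - 1
      else ncf_quot \<gamma> k - 2)"

definition is_E_rep :: "real \<Rightarrow> real \<Rightarrow> (nat \<Rightarrow> int) \<Rightarrow> bool" where
  "is_E_rep \<gamma> x b \<longleftrightarrow>
     (\<lambda>k. of_int (b k) * ncf_D \<gamma> (Suc k)) sums x \<and>
     (b = dav_digit \<gamma> x \<or>
      (\<exists>m. dav_digit \<gamma> x m \<ge> 1 \<and> (\<forall>k>m. dav_digit \<gamma> x k = 0) \<and>
           b = alt_digits \<gamma> (dav_digit \<gamma> x) m))"

definition E_set :: "real \<Rightarrow> nat \<Rightarrow> real set" where
  "E_set \<gamma> s = {x. 0 \<le> x \<and> x \<le> 1 \<and>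
     (\<exists>b. is_E_rep \<gamma> x b \<and> \<not> has_zero_block s b \<and> \<not> has_E_block \<gamma> s b)}"

end

theory Submission
  imports Defs
begin

text \<open>
  Put $t = r^2$ and look for $x$ just above $r$ with $y = t/x$. Each of the excluded blocks is a
  fixed word of length $s+1$ starting at some position $i$. The numbers having that word at $i$
  fall into clusters of diameter at most $R^{s+1} D_i$, while distinct clusters lie at distance
  at least of order $D_i/(N+1)$, because a cylinder of level $i$ has length at least
  $D_i(1-\gamma_{i+1})$. For large $s$ the clusters are so thin that a nested-interval
  construction avoids all of them for $x$ and $y$ simultaneously: a stage treats the clusters with
  $D_i \in [R^m e, e)$, at most $4m$ of which meet the current interval, and continues
  with a free subinterval that is shorter by the factor $R^m < 1/(4m+1)$ only.

  The first interval has length of order $\rho = \min(r, 1-r) \geq R^s$. The clusters with $D_i$ large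
  compared to $\rho$ miss it, since every cluster is either within $R^{s+1}$ of an end point of $[0,1]$ or
  at distance at least of order $D_i$ from it; only here the bound on the $g_i$ is used.
\<close>

section \<open>Avoiding thin clusters on all scales\<close>

text \<open>Pigeonhole: \<open>M + 1\<close> candidate intervals of length
  \<open>\<theta> * l\<close> are placed in the window with gaps \<open>\<eta>\<close> between them.
  Two points of \<open>Bad i\<close> in the window are closer than \<open>\<eta>\<close>, so each
  \<open>Bad i\<close> hits at most one candidate, and some candidate stays free.\<close>

lemma gap_free_piece:
  fixes Bad :: "'i \<Rightarrow> real set" and u l \<eta> \<theta> :: real
  assumes fin: "finite I" and card: "card I \<le> M" and pos: "0 < \<theta>" "0 < l" "0 < \<eta>"
    and room: "(real M + 1) * (\<theta> * l) + real M * \<eta> \<le> l"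
    and sep: "\<And>i x y. i \<in> I \<Longrightarrow> x \<in> Bad i \<Longrightarrow> y \<in> Bad i \<Longrightarrow> x \<in> {u..u + l} \<Longrightarrow> y \<in> {u..u + l} \<Longrightarrow>
      \<bar>x - y\<bar> < \<eta>"
  shows "\<exists>v. u \<le> v \<and> v + \<theta> * l \<le> u + l \<and> (\<forall>i\<in>I. Bad i \<inter> {v..v + \<theta> * l} = {})"
proof (rule ccontr)
  assume no: "\<not> ?thesis"
  define p where "p k = u + real k * (\<theta> * l + \<eta>)" for k
  have tl: "0 < \<theta> * l" using pos by simp
  have inside: "u \<le> p k \<and> p k + \<theta> * l \<le> u + l" if "k \<le> M" for k
  proof -
    have "real k * (\<theta> * l + \<eta>) \<le> real M * (\<theta> * l + \<eta>)"
      using that pos tl by (intro mult_right_mono) auto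
    then have "p k + \<theta> * l \<le> u + l" using room by (simp add: p_def algebra_simps)
    then show ?thesis using pos tl by (simp add: p_def)
  qed
  have "\<exists>i\<in>I. \<exists>x. x \<in> Bad i \<and> x \<in> {p k..p k + \<theta> * l}" if "k \<le> M" for k
    using no inside[OF that] by blast
  then obtain f h where f: "\<And>k. k \<le> M \<Longrightarrow> f k \<in> I"
    and h: "\<And>k. k \<le> M \<Longrightarrow> h k \<in> Bad (f k) \<and> h k \<in> {p k..p k + \<theta> * l}"
    by metis
  have far: "h k + \<eta> \<le> h k'" if "k < k'" "k' \<le> M" for k k'
  proof -
    have "real (Suc k) * (\<theta> * l + \<eta>) \<le> real k' * (\<theta> * l + \<eta>)"
      using that pos tl by (intro mult_right_mono) auto
    then have "p k + (\<theta> * l + \<eta>) \<le> p k'" by (simp add: p_def algebra_simps)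
    then show ?thesis using h[of k] h[of k'] that by auto
  qed
  have "inj_on f {..M}"
  proof (rule linorder_inj_onI)
    fix k k' assume kk: "k < k'" "k \<in> {..M}" "k' \<in> {..M}"
    show "f k \<noteq> f k'"
    proof
      assume eq: "f k = f k'"
      have "\<bar>h k - h k'\<bar> < \<eta>"
        using h[of k] h[of k'] inside[of k] inside[of k'] f[of k] kk eq
        by (intro sep[of "f k"]) auto
      then show False using far[of k k'] kk by auto
    qed
  qed auto
  then have "card {..M} \<le> card I"
    by (rule card_inj_on_le) (use f fin in auto)
  then show False using card by simp
qed

text \<open>The number \<open>d i\<close> is the scale of \<open>Bad i\<close>: by
  \<open>sep\<close>, a window of length at most \<open>c * d i\<close> sees only one cluster, of
  diameter at most \<open>\<delta> * d i\<close>. Stage \<open>n\<close> removes the scales from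
  \<open>a * \<theta> ^ Suc n\<close> up to \<open>a * \<theta> ^ n\<close> by
  \<open>gap_free_piece\<close>; \<open>coarse\<close> covers the scales from \<open>a\<close>
  on.\<close>

lemma multiscale_avoidance:
  fixes Bad :: "'i \<Rightarrow> real set" and d :: "'i \<Rightarrow> real"
  assumes dpos: "\<And>i. 0 < d i" and \<theta>: "0 < \<theta>" "\<theta> < 1" and apos: "0 < a" and lam: "0 < \<kappa>"
    and count: "\<And>e. 0 < e \<Longrightarrow> finite {i. \<theta> * e \<le> d i \<and> d i < e} \<and> card {i. \<theta> * e \<le> d i \<and> d i < e} \<le> M"
    and room: "(real M + 1) * \<theta> \<le> 1 / 2"
    and small: "\<kappa> \<le> c * \<theta>" "2 * real M * \<delta> < \<kappa>"
    and sep: "\<And>i x y. x \<in> Bad i \<Longrightarrow> y \<in> Bad i \<Longrightarrow> x \<in> {u..u + \<kappa> * a} \<Longrightarrow> y \<in> {u..u + \<kappa> * a} \<Longrightarrow>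
      \<bar>x - y\<bar> \<le> c * d i \<Longrightarrow> \<bar>x - y\<bar> \<le> \<delta> * d i"
    and coarse: "\<And>i. a \<le> d i \<Longrightarrow> Bad i \<inter> {u..u + \<kappa> * a} = {}"
    and M: "1 \<le> M" and \<delta>: "0 \<le> \<delta>"
  shows "\<exists>x\<in>{u..u + \<kappa> * a}. \<forall>i. x \<notin> Bad i"
proof -
  define l where "l n = \<kappa> * (a * \<theta> ^ n)" for n
  have lpos: "0 < l n" for n using lam apos \<theta> by (simp add: l_def)
  have l0: "l 0 = \<kappa> * a" by (simp add: l_def)
  have lSuc: "l (Suc n) = \<theta> * l n" for n by (simp add: l_def)
  define lev where "lev n = {i. \<theta> * (a * \<theta> ^ n) \<le> d i \<and> d i < a * \<theta> ^ n}" for n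
  have step: "\<exists>w. v \<le> w \<and> w + l (Suc n) \<le> v + l n \<and> (\<forall>i\<in>lev n. Bad i \<inter> {w..w + l (Suc n)} = {})"
    if v: "u \<le> v" "v + l n \<le> u + l 0" for v n
  proof -
    define e where "e = a * \<theta> ^ n"
    have e: "0 < e" using apos \<theta> by (simp add: e_def)
    have le: "l n = \<kappa> * e" by (simp add: l_def e_def)
    \<comment> \<open>Half of the window pays for the \<open>M\<close> gaps; \<open>room\<close>
      leaves the other half to the \<open>M + 1\<close> pieces.\<close>
    define \<eta> where "\<eta> = l n / (2 * real M)"
    have de: "\<delta> * e < \<eta>"
      using M small(2) e by (simp add: \<eta>_def le field_simps)
    show ?thesis unfolding lSuc
    proof (rule gap_free_piece[where M = M and \<eta> = \<eta>])
      show "finite (lev n)" "card (lev n) \<le> M"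
        using count[OF e] by (auto simp: lev_def e_def)
      show "0 < \<eta>" using M lpos[of n] by (simp add: \<eta>_def)
      have "(real M + 1) * \<theta> * l n \<le> 1 / 2 * l n"
        using room lpos[of n] by (intro mult_right_mono) auto
      moreover have "real M * \<eta> = l n / 2" using M by (simp add: \<eta>_def)
      ultimately show "(real M + 1) * (\<theta> * l n) + real M * \<eta> \<le> l n" by (simp add: algebra_simps)
      fix i x y
      assume i: "i \<in> lev n" and xy: "x \<in> Bad i" "y \<in> Bad i" "x \<in> {v..v + l n}" "y \<in> {v..v + l n}"
      have di: "\<theta> * e \<le> d i" "d i < e" using i by (auto simp: lev_def e_def)
      have "0 < c" using small(1) lam \<theta> by (smt (verit) mult_nonpos_nonneg)
      \<comment> \<open>By \<open>\<kappa> \<le> c * \<theta>\<close> the whole window is at most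
        \<open>c * d i\<close> long, so \<open>sep\<close> applies to any two bad points in
        it.\<close>
      have "\<bar>x - y\<bar> \<le> l n" using xy by auto
      also have "\<dots> \<le> c * \<theta> * e" unfolding le using small(1) e by (intro mult_right_mono) auto
      also have "\<dots> \<le> c * d i" using di \<open>0 < c\<close> by (simp add: mult.assoc)
      finally have "\<bar>x - y\<bar> \<le> \<delta> * d i" using xy v by (intro sep) (auto simp: l0)
      also have "\<dots> \<le> \<delta> * e" using di \<delta> by (intro mult_left_mono) auto
      finally show "\<bar>x - y\<bar> < \<eta>" using de by simp
    qed (use \<theta> lpos in auto)
  qed
  define nxt where "nxt n v = (SOME w. v \<le> w \<and> w + l (Suc n) \<le> v + l n \<and>
      (\<forall>i\<in>lev n. Bad i \<inter> {w..w + l (Suc n)} = {}))" for n v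
  define v where "v = rec_nat u nxt"
  have v0: "v 0 = u" and vSuc: "v (Suc n) = nxt n (v n)" for n by (simp_all add: v_def)
  \<comment> \<open>Both claims need one induction: the choice \<open>nxt\<close> is justified only
    for a window inside the first one, and its property carries that inclusion to the next
    stage.\<close>
  have inv: "u \<le> v n \<and> v n + l n \<le> u + l 0" and
    nxt: "v n \<le> v (Suc n) \<and> v (Suc n) + l (Suc n) \<le> v n + l n \<and>
      (\<forall>i\<in>lev n. Bad i \<inter> {v (Suc n)..v (Suc n) + l (Suc n)} = {})" for n
  proof (induction n)
    case 0
    { case 1 then show ?case by (simp add: v0) }
    { case 2 show ?case unfolding vSuc unfolding nxt_def
        by (rule someI_ex[OF step]) (simp_all add: v0) }
  next
    case (Suc n)
    { case 1 then show ?case using Suc by auto }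
    { case 2 show ?case unfolding vSuc[of "Suc n"] unfolding nxt_def[of "Suc n"]
        by (rule someI_ex[OF step]) (use Suc in auto) }
  qed
  have mono: "incseq v" using nxt by (intro incseq_SucI) auto
  have anti: "decseq (\<lambda>n. v n + l n)" using nxt by (intro decseq_SucI) auto
  have below: "v n \<le> v k + l k" for n k
  proof -
    have "v n \<le> v (max n k)" using mono by (simp add: incseqD)
    also have "\<dots> \<le> v (max n k) + l (max n k)" using lpos[of "max n k"] by simp
    also have "\<dots> \<le> v k + l k" using decseqD[OF anti, of k "max n k"] by simp
    finally show ?thesis .
  qed
  define x where "x = (SUP n. v n)"
  have bdd: "bdd_above (range v)" using below[of _ 0] by (auto simp: bdd_above_def)
  have xin: "x \<in> {v n..v n + l n}" for n
    unfolding x_def using below bdd by (auto intro!: cSUP_upper cSUP_least)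
  have "x \<notin> Bad i" for i
  proof (cases "a \<le> d i")
    case True
    then show ?thesis using coarse[OF True] xin[of 0] by (auto simp: v0 l0)
  next
    case False
    have "(\<lambda>n. a * \<theta> ^ n) \<longlonglongrightarrow> a * 0"
      using \<theta> by (intro tendsto_mult tendsto_const LIMSEQ_realpow_zero) auto
    then have "\<forall>\<^sub>F n in sequentially. a * \<theta> ^ n < d i"
      using dpos[of i] by (intro order_tendstoD(2)[where a = "d i"]) auto
    then obtain n0 where n0: "a * \<theta> ^ n0 < d i"
      by (auto simp: eventually_sequentially)
    \<comment> \<open>The stage whose range of scales contains \<open>d i\<close>; minimality and
      \<open>d i < a\<close> give the upper bound.\<close>
    define n where "n = (LEAST n. a * \<theta> ^ Suc n \<le> d i)"
    have ex: "a * \<theta> ^ Suc n0 \<le> d i"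
    proof -
      have "\<theta> * (a * \<theta> ^ n0) \<le> 1 * (a * \<theta> ^ n0)"
        using \<theta> apos by (intro mult_right_mono) auto
      then show ?thesis using n0 by (simp add: mult_ac)
    qed
    have n: "a * \<theta> ^ Suc n \<le> d i" unfolding n_def by (rule LeastI[of _ n0]) (rule ex)
    have "d i < a * \<theta> ^ n"
    proof (cases n)
      case 0
      then show ?thesis using False by simp
    next
      case (Suc k)
      then show ?thesis using not_less_Least[of k "\<lambda>n. a * \<theta> ^ Suc n \<le> d i"]
        unfolding n_def[symmetric] by simp
    qed
    with n have "i \<in> lev n" by (simp add: lev_def mult_ac)
    then have "Bad i \<inter> {v (Suc n)..v (Suc n) + l (Suc n)} = {}" using nxt[of n] by blast
    then show ?thesis using xin[of "Suc n"] by blast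
  qed
  then show ?thesis using xin[of 0] unfolding v0 l0 by blast
qed

section \<open>Remainders and products of a negative continued fraction\<close>

locale negative_cf =
  fixes \<gamma> :: real
  assumes gamma: "0 < \<gamma>" "\<gamma> < 1" "\<gamma> \<notin> \<rat>"
begin

text \<open>Irrationality is carried through the induction because it keeps the reciprocal from
  being an integer, which would make the next remainder 0.\<close>

lemma rem_irrational: "0 < ncf_rem \<gamma> i \<and> ncf_rem \<gamma> i < 1 \<and> ncf_rem \<gamma> i \<notin> \<rat>"
proof (induction i)
  case 0
  then show ?case using gamma by simp
next
  case (Suc i)
  let ?y = "1 / ncf_rem \<gamma> i"
  have "?y \<notin> \<rat>"
  proof
    assume "?y \<in> \<rat>"
    then have "inverse ?y \<in> \<rat>" by (rule Rats_inverse)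
    then show False using Suc.IH by simp
  qed
  then have "of_int \<lceil>?y\<rceil> - ?y \<notin> \<rat>"
    using Rats_diff[of "of_int \<lceil>?y\<rceil>" "of_int \<lceil>?y\<rceil> - ?y"] by auto
  moreover from this have "of_int \<lceil>?y\<rceil> - ?y \<noteq> 0" by (metis Rats_0)
  moreover have "of_int \<lceil>?y\<rceil> - 1 < ?y" "?y \<le> of_int \<lceil>?y\<rceil>" using ceiling_correct[of ?y] by auto
  ultimately show ?case unfolding ncf_rem.simps by linarith
qed

lemma rem_pos [simp]: "0 < ncf_rem \<gamma> i" and rem_less_1: "ncf_rem \<gamma> i < 1"
  using rem_irrational by auto

lemma rem_nz [simp]: "ncf_rem \<gamma> i \<noteq> 0"
  using rem_pos[of i] by linarith

lemma rem_inverse: "1 / ncf_rem \<gamma> i = of_int (ncf_quot \<gamma> i) - ncf_rem \<gamma> (Suc i)"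
  by (simp add: ncf_quot_def)

lemma rem_mult: "ncf_rem \<gamma> i * (of_int (ncf_quot \<gamma> i) - ncf_rem \<gamma> (Suc i)) = 1"
  unfolding rem_inverse[symmetric] by simp

lemma quot_ge_2: "2 \<le> ncf_quot \<gamma> i"
proof -
  have "1 < 1 / ncf_rem \<gamma> i" using rem_less_1[of i] by (simp add: field_simps)
  then show ?thesis unfolding ncf_quot_def by linarith
qed

lemma D_0 [simp]: "ncf_D \<gamma> 0 = 1"
  by (simp add: ncf_D_def)

lemma D_Suc: "ncf_D \<gamma> (Suc i) = ncf_D \<gamma> i * ncf_rem \<gamma> i"
  by (simp add: ncf_D_def)

lemma D_pos [simp]: "0 < ncf_D \<gamma> i"
  by (simp add: ncf_D_def prod_pos)

text \<open>The three-term recurrence \<open>D_(i-1) = g_i D_i - D_(i+1)\<close>, with the last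
  product factored.\<close>

lemma D_recurrence:
  "ncf_D \<gamma> i = (of_int (ncf_quot \<gamma> i) - ncf_rem \<gamma> (Suc i)) * ncf_D \<gamma> (Suc i)"
  using rem_mult[of i] by (simp add: D_Suc algebra_simps)

lemma D_antimono: "i \<le> j \<Longrightarrow> ncf_D \<gamma> j \<le> ncf_D \<gamma> i"
proof (induction rule: dec_induct)
  case (step n)
  have "ncf_D \<gamma> n * ncf_rem \<gamma> n \<le> ncf_D \<gamma> n * 1"
    using rem_less_1[of n] by (intro mult_left_mono) (auto simp: less_imp_le)
  also have "\<dots> \<le> ncf_D \<gamma> i" using step by simp
  finally show ?case by (simp add: D_Suc)
qed simp

section \<open>Davenport expansions and the lengths of cylinders\<close>

text \<open>Serves as the left end of the cylinder of level \<open>i\<close> around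
  \<open>x\<close>: numbers sharing its first \<open>i\<close> digits exceed it by
  \<open>ncf_D \<gamma> i\<close> times their remainder.\<close>

definition dav_base :: "real \<Rightarrow> nat \<Rightarrow> real" where
  "dav_base x i = (\<Sum>k<i. of_int (dav_digit \<gamma> x k) * ncf_D \<gamma> (Suc k))"

lemma dav_base_simps [simp]:
  "dav_base x 0 = 0"
  "dav_base x (Suc i) = dav_base x i + of_int (dav_digit \<gamma> x i) * ncf_D \<gamma> (Suc i)"
  by (simp_all add: dav_base_def)

lemma dav_rem_step:
  "dav_rem \<gamma> x i = ncf_rem \<gamma> i * (of_int (dav_digit \<gamma> x i) + dav_rem \<gamma> x (Suc i))"
  by (simp add: dav_digit_def)

lemma dav_expansion: "x = dav_base x i + ncf_D \<gamma> i * dav_rem \<gamma> x i"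
proof (induction i)
  case (Suc i)
  then show ?case using dav_rem_step[of x i] by (simp add: D_Suc algebra_simps del: dav_rem.simps)
qed simp

context
  fixes x :: real
  assumes x01: "0 \<le> x" "x < 1"
begin

lemma dav_rem_bounds: "0 \<le> dav_rem \<gamma> x i" "dav_rem \<gamma> x i < 1"
proof -
  have "0 \<le> dav_rem \<gamma> x i \<and> dav_rem \<gamma> x i < 1"
    by (cases i) (use x01 in \<open>auto simp: frac_def[symmetric] frac_lt_1\<close>)
  then show "0 \<le> dav_rem \<gamma> x i" "dav_rem \<gamma> x i < 1" by auto
qed

lemma dav_digit_nonneg: "0 \<le> dav_digit \<gamma> x i"
  using dav_rem_bounds[of i] less_imp_le[OF rem_pos] by (simp add: dav_digit_def)

lemma dav_digit_le: "dav_digit \<gamma> x i \<le> ncf_quot \<gamma> i - 1"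
proof -
  have "dav_rem \<gamma> x i / ncf_rem \<gamma> i < 1 / ncf_rem \<gamma> i"
    using dav_rem_bounds[of i] by (simp add: divide_strict_right_mono)
  then show ?thesis unfolding rem_inverse dav_digit_def using rem_pos[of "Suc i"] by linarith
qed

text \<open>Digit plus next remainder is less than \<open>1 / ncf_rem \<gamma> i\<close>, that is,
  \<open>g\<close> minus the next \<open>ncf_rem\<close>. A remainder bounded in this way is called
  restricted below: it forbids the digit \<open>g - 1\<close> and stays restricted after the digit
  \<open>g - 2\<close>, while smaller digits impose nothing on the next remainder.\<close>

lemma dav_rem_after_top:
  assumes "dav_digit \<gamma> x i = ncf_quot \<gamma> i - 1"
  shows "dav_rem \<gamma> x (Suc i) < 1 - ncf_rem \<gamma> (Suc i)"
proof -
  have "ncf_rem \<gamma> i * (of_int (dav_digit \<gamma> x i) + dav_rem \<gamma> x (Suc i))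
      < ncf_rem \<gamma> i * (of_int (ncf_quot \<gamma> i) - ncf_rem \<gamma> (Suc i))"
    unfolding rem_mult dav_rem_step[symmetric] by (rule dav_rem_bounds)
  then show ?thesis using assms by (simp del: dav_rem.simps ncf_rem.simps)
qed

lemma restricted_step:
  assumes "dav_rem \<gamma> x i < 1 - ncf_rem \<gamma> i"
  shows "of_int (dav_digit \<gamma> x i) + dav_rem \<gamma> x (Suc i)
    < of_int (ncf_quot \<gamma> i) - 1 - ncf_rem \<gamma> (Suc i)"
proof -
  have "ncf_rem \<gamma> i * (of_int (dav_digit \<gamma> x i) + dav_rem \<gamma> x (Suc i))
      < ncf_rem \<gamma> i * (of_int (ncf_quot \<gamma> i) - 1 - ncf_rem \<gamma> (Suc i))"
    using assms rem_mult[of i] unfolding dav_rem_step[symmetric] by (simp add: algebra_simps)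
  then show ?thesis by (simp del: dav_rem.simps ncf_rem.simps)
qed

lemma restricted_digit:
  assumes "dav_rem \<gamma> x i < 1 - ncf_rem \<gamma> i"
  shows "dav_digit \<gamma> x i \<le> ncf_quot \<gamma> i - 2"
  using restricted_step[OF assms] dav_rem_bounds[of "Suc i"] rem_pos[of "Suc i"] by linarith

lemma restricted_persists:
  assumes "dav_rem \<gamma> x i < 1 - ncf_rem \<gamma> i" and "\<forall>j<n. dav_digit \<gamma> x (i + j) = ncf_quot \<gamma> (i + j) - 2"
  shows "dav_rem \<gamma> x (i + n) < 1 - ncf_rem \<gamma> (i + n)"
  using assms(2)
proof (induction n)
  case 0
  then show ?case using assms(1) by simp
next
  case (Suc n)
  then have "dav_rem \<gamma> x (i + n) < 1 - ncf_rem \<gamma> (i + n)" by simp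
  from restricted_step[OF this] show ?case using Suc.prems
    by (simp del: dav_rem.simps ncf_rem.simps)
qed

lemma dav_base_mono: "i \<le> j \<Longrightarrow> dav_base x i \<le> dav_base x j"
proof (induction rule: dec_induct)
  case (step n)
  then show ?case using dav_digit_nonneg[of n] by (simp add: add_increasing2 less_imp_le)
qed simp

lemma full_step:
  assumes "dav_digit \<gamma> x i \<le> ncf_quot \<gamma> i - 2"
  shows "dav_base x (Suc i) + ncf_D \<gamma> (Suc i) + ncf_D \<gamma> (Suc i) * (1 - ncf_rem \<gamma> (Suc i))
    \<le> dav_base x i + ncf_D \<gamma> i"
proof -
  have "(of_int (dav_digit \<gamma> x i)) * ncf_D \<gamma> (Suc i) \<le> (of_int (ncf_quot \<gamma> i) - 2) * ncf_D \<gamma> (Suc i)"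
    using assms by (intro mult_right_mono) (auto simp: less_imp_le)
  then show ?thesis using D_recurrence[of i]
    by (simp add: algebra_simps del: dav_rem.simps ncf_rem.simps)
qed

text \<open>One step of a two-state induction: either the full length fits below
  \<open>\<beta>\<close>, or \<open>x\<close> is restricted and only the shortened length has to
  fit. The first alternative of the conclusion keeps the spare length from \<open>full_step\<close>
  for use in \<open>full_cylinder_gap\<close>.\<close>

lemma cylinder_bound_aux:
  assumes "dav_base x i + ncf_D \<gamma> i \<le> \<beta> \<or>
    dav_rem \<gamma> x i < 1 - ncf_rem \<gamma> i \<and> dav_base x i + ncf_D \<gamma> i * (1 - ncf_rem \<gamma> i) \<le> \<beta>"
  shows "dav_base x (Suc i) + ncf_D \<gamma> (Suc i) + ncf_D \<gamma> (Suc i) * (1 - ncf_rem \<gamma> (Suc i)) \<le> \<beta> \<or>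
    dav_rem \<gamma> x (Suc i) < 1 - ncf_rem \<gamma> (Suc i) \<and>
      dav_base x (Suc i) + ncf_D \<gamma> (Suc i) * (1 - ncf_rem \<gamma> (Suc i)) \<le> \<beta>"
  using assms
proof
  assume full: "dav_base x i + ncf_D \<gamma> i \<le> \<beta>"
  show ?thesis
  proof (cases "dav_digit \<gamma> x i = ncf_quot \<gamma> i - 1")
    case True
    then have digit: "real_of_int (dav_digit \<gamma> x i) = of_int (ncf_quot \<gamma> i) - 1" by simp
    have "dav_base x (Suc i) + ncf_D \<gamma> (Suc i) * (1 - ncf_rem \<gamma> (Suc i)) = dav_base x i + ncf_D \<gamma> i"
      unfolding dav_base_simps digit using D_recurrence[of i]
      by (simp add: algebra_simps del: dav_rem.simps ncf_rem.simps)
    then show ?thesis using full dav_rem_after_top[OF True] by simp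
  next
    case False
    then have "dav_digit \<gamma> x i \<le> ncf_quot \<gamma> i - 2" using dav_digit_le[of i] by simp
    from full_step[OF this] show ?thesis using full by simp
  qed
next
  assume res: "dav_rem \<gamma> x i < 1 - ncf_rem \<gamma> i \<and> dav_base x i + ncf_D \<gamma> i * (1 - ncf_rem \<gamma> i) \<le> \<beta>"
  \<comment> \<open>The shortened length is
    \<open>ncf_D \<gamma> i - ncf_D \<gamma> (Suc i)\<close>. A digit \<open>g - 2\<close> leads to
    a restricted child ending exactly there; a digit at most \<open>g - 3\<close> leaves room for a
    full child with spare length.\<close>
  then have le: "dav_base x i + ncf_D \<gamma> i - ncf_D \<gamma> (Suc i) \<le> \<beta>" by (simp add: D_Suc algebra_simps)
  show ?thesis
  proof (cases "dav_digit \<gamma> x i = ncf_quot \<gamma> i - 2")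
    case True
    then have digit: "real_of_int (dav_digit \<gamma> x i) = of_int (ncf_quot \<gamma> i) - 2" by simp
    have "dav_base x (Suc i) + ncf_D \<gamma> (Suc i) * (1 - ncf_rem \<gamma> (Suc i))
        = dav_base x i + ncf_D \<gamma> i - ncf_D \<gamma> (Suc i)"
      unfolding dav_base_simps digit using D_recurrence[of i]
      by (simp add: algebra_simps del: dav_rem.simps ncf_rem.simps)
    moreover have "dav_rem \<gamma> x (Suc i) < 1 - ncf_rem \<gamma> (Suc i)"
      using restricted_persists[of i 1] True res by simp
    ultimately show ?thesis using le by simp
  next
    case False
    then have "dav_digit \<gamma> x i \<le> ncf_quot \<gamma> i - 3" using restricted_digit[of i] res by simp
    then have "(of_int (dav_digit \<gamma> x i)) * ncf_D \<gamma> (Suc i) \<le> (of_int (ncf_quot \<gamma> i) - 3) * ncf_D \<gamma> (Suc i)"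
      by (intro mult_right_mono) (auto simp: less_imp_le)
    then have "dav_base x (Suc i) + ncf_D \<gamma> (Suc i) + ncf_D \<gamma> (Suc i) * (1 - ncf_rem \<gamma> (Suc i))
        \<le> dav_base x i + ncf_D \<gamma> i - ncf_D \<gamma> (Suc i)"
      using D_recurrence[of i] by (simp add: algebra_simps del: dav_rem.simps ncf_rem.simps)
    then show ?thesis using le by simp
  qed
qed

lemma cylinder_bound:
  assumes "dav_base x k + ncf_D \<gamma> k \<le> \<beta>" and "k \<le> i"
  shows "dav_base x i + ncf_D \<gamma> i \<le> \<beta> \<or>
    dav_rem \<gamma> x i < 1 - ncf_rem \<gamma> i \<and> dav_base x i + ncf_D \<gamma> i * (1 - ncf_rem \<gamma> i) \<le> \<beta>"
  using assms(2)
proof (induction rule: dec_induct)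
  case (step n)
  have "0 \<le> ncf_D \<gamma> (Suc n) * (1 - ncf_rem \<gamma> (Suc n))"
    using rem_less_1[of "Suc n"] by (simp add: less_imp_le del: ncf_rem.simps)
  with cylinder_bound_aux[OF step.IH] show ?case by linarith
qed (use assms in simp)

lemma cylinder_bound_weak:
  assumes "dav_base x k + ncf_D \<gamma> k \<le> \<beta>" and "k \<le> i"
  shows "dav_base x i + ncf_D \<gamma> i * (1 - ncf_rem \<gamma> i) \<le> \<beta>"
proof -
  have "ncf_D \<gamma> i * (1 - ncf_rem \<gamma> i) \<le> ncf_D \<gamma> i * 1"
    by (intro mult_left_mono) (auto simp: less_imp_le)
  then show ?thesis using cylinder_bound[OF assms] by linarith
qed

text \<open>A remainder this large excludes the restricted alternative of
  \<open>cylinder_bound_aux\<close>, so the one with spare length holds. At \<open>i = 0\<close> no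
  step precedes, and the cylinder fills the unit interval.\<close>

lemma full_cylinder_gap:
  assumes "1 - ncf_rem \<gamma> i \<le> dav_rem \<gamma> x i" and "0 < i"
  shows "dav_base x i + ncf_D \<gamma> i + ncf_D \<gamma> i * (1 - ncf_rem \<gamma> i) \<le> 1"
proof -
  obtain k where k: "i = Suc k" using assms(2) by (cases i) auto
  have "dav_base x k + ncf_D \<gamma> k \<le> 1 \<or>
    dav_rem \<gamma> x k < 1 - ncf_rem \<gamma> k \<and> dav_base x k + ncf_D \<gamma> k * (1 - ncf_rem \<gamma> k) \<le> 1"
    by (rule cylinder_bound[of 0]) auto
  from cylinder_bound_aux[OF this] show ?thesis using assms k by auto
qed

end

text \<open>At the first differing digit the cylinder of the smaller number ends no later than that
  of the larger one begins. Its subcylinder of level \<open>i\<close> lies in between and has at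
  least the shortened length.\<close>

lemma base_gap:
  assumes "0 \<le> x" "x < 1" "0 \<le> y" "y < 1" and "dav_base x i \<noteq> dav_base y i"
  shows "ncf_D \<gamma> i * (1 - ncf_rem \<gamma> i) \<le> \<bar>dav_base x i - dav_base y i\<bar>"
proof -
  have main: "dav_base x i + ncf_D \<gamma> i * (1 - ncf_rem \<gamma> i) \<le> dav_base y i"
    if "0 \<le> x" "x < 1" "0 \<le> y" "y < 1" "k < i" "dav_base x k = dav_base y k"
      "dav_digit \<gamma> x k < dav_digit \<gamma> y k" for x y k
  proof -
    have "(of_int (dav_digit \<gamma> x k) + 1) * ncf_D \<gamma> (Suc k) \<le> of_int (dav_digit \<gamma> y k) * ncf_D \<gamma> (Suc k)"
      using that by (intro mult_right_mono) (auto simp: less_imp_le)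
    then have "dav_base x (Suc k) + ncf_D \<gamma> (Suc k) \<le> dav_base y (Suc k)"
      using that by (simp add: algebra_simps)
    then have "dav_base x i + ncf_D \<gamma> i * (1 - ncf_rem \<gamma> i) \<le> dav_base y (Suc k)"
      using that by (intro cylinder_bound_weak[where k = "Suc k"]) auto
    also have "\<dots> \<le> dav_base y i" using that by (intro dav_base_mono) auto
    finally show ?thesis .
  qed
  \<comment> \<open>The shift by one is harmless since bases of level 0 agree. The least
    \<open>k\<close> has equal bases at level \<open>k\<close> and different ones at
    \<open>Suc k\<close>, hence different digits at \<open>k\<close>.\<close>
  define P where "P k \<longleftrightarrow> dav_base x (Suc k) \<noteq> dav_base y (Suc k)" for k
  obtain i' where i': "i = Suc i'" using assms(5) by (cases i) auto
  then have "P i'" using assms(5) by (simp add: P_def)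
  then obtain k where k: "P k" "\<forall>n<k. \<not> P n" using exists_least_iff[of P] by blast
  then have "k \<le> i'" using \<open>P i'\<close> by (meson not_less)
  have "dav_base x k = dav_base y k"
  proof (cases k)
    case (Suc n)
    then show ?thesis using k(2) unfolding P_def by blast
  qed simp
  with k(1) have "dav_digit \<gamma> x k < dav_digit \<gamma> y k \<or> dav_digit \<gamma> y k < dav_digit \<gamma> x k"
    by (auto simp: P_def)
  then show ?thesis
    using main[of x y k] main[of y x k] \<open>k \<le> i'\<close> i' assms \<open>dav_base x k = dav_base y k\<close> by auto
qed

text \<open>Each common digit cancels in \<open>dav_rem_step\<close>, leaving the factor
  \<open>ncf_rem \<gamma> i\<close>, which is at most \<open>R\<close>.\<close>

lemma word_contraction:
  assumes "0 \<le> x" "x < 1" "0 \<le> y" "y < 1" and R: "\<And>i. ncf_rem \<gamma> i \<le> R"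
    and "\<forall>j<n. dav_digit \<gamma> x (i + j) = dav_digit \<gamma> y (i + j)"
  shows "\<bar>dav_rem \<gamma> x i - dav_rem \<gamma> y i\<bar> \<le> R ^ n"
  using assms(6)
proof (induction n arbitrary: i)
  case 0
  show ?case using dav_rem_bounds[OF assms(1,2), of i] dav_rem_bounds[OF assms(3,4), of i]
    by (auto simp: abs_le_iff)
next
  case (Suc n)
  have "dav_rem \<gamma> x i - dav_rem \<gamma> y i = ncf_rem \<gamma> i * (dav_rem \<gamma> x (Suc i) - dav_rem \<gamma> y (Suc i))"
    using Suc.prems[rule_format, of 0] dav_rem_step[of x i] dav_rem_step[of y i]
    by (simp add: algebra_simps del: dav_rem.simps)
  then have "\<bar>dav_rem \<gamma> x i - dav_rem \<gamma> y i\<bar>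
      = ncf_rem \<gamma> i * \<bar>dav_rem \<gamma> x (Suc i) - dav_rem \<gamma> y (Suc i)\<bar>"
    by (simp add: abs_mult less_imp_le del: dav_rem.simps)
  also have "\<bar>dav_rem \<gamma> x (Suc i) - dav_rem \<gamma> y (Suc i)\<bar> \<le> R ^ n"
    using Suc.prems by (intro Suc.IH) (metis Suc_less_eq add_Suc_shift)
  then have "ncf_rem \<gamma> i * \<bar>dav_rem \<gamma> x (Suc i) - dav_rem \<gamma> y (Suc i)\<bar> \<le> R * R ^ n"
    using R[of i] order_trans[OF less_imp_le[OF rem_pos] R] by (intro mult_mono) (auto simp del: dav_rem.simps)
  finally show ?case by simp
qed

end

section \<open>Uniform contraction from bounded quotients without long runs of twos\<close>

locale negative_cf_bounded = negative_cf +
  fixes N :: nat and B :: int and R :: real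
  assumes quot_le: "ncf_quot \<gamma> i \<le> B"
    and N_pos: "1 \<le> N"
    and no_twos: "\<exists>j<N. ncf_quot \<gamma> (i + j) \<noteq> 2"
    and R_def: "R = real N / (real N + 1)"
begin

lemma R_bounds: "0 < R" "R < 1" "1 - R = 1 / (real N + 1)"
  using N_pos by (auto simp: R_def field_simps)

text \<open>A quotient at least 3 forces a remainder at most 1/2. Going back one place over a
  quotient at least 2 applies \<open>u \<mapsto> 1 / (2 - u)\<close>, which sends
  \<open>(j + 1) / (j + 2)\<close> to \<open>(j + 2) / (j + 3)\<close>. A quotient other than 2
  occurs for some \<open>j < N\<close>.\<close>

lemma rem_le_R: "ncf_rem \<gamma> i \<le> R"
proof -
  have aux: "ncf_rem \<gamma> i \<le> (real j + 1) / (real j + 2)" if "3 \<le> ncf_quot \<gamma> (i + j)" for i j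
    using that
  proof (induction j arbitrary: i)
    case 0
    have "ncf_rem \<gamma> i * 2 \<le> ncf_rem \<gamma> i * (of_int (ncf_quot \<gamma> i) - ncf_rem \<gamma> (Suc i))"
      using 0 rem_less_1[of "Suc i"]
      by (intro mult_left_mono) (auto simp: less_imp_le simp del: ncf_rem.simps)
    then show ?case unfolding rem_mult by simp
  next
    case (Suc j)
    then have IH: "ncf_rem \<gamma> (Suc i) \<le> (real j + 1) / (real j + 2)" by (simp del: ncf_rem.simps)
    have "ncf_rem \<gamma> i * (2 - (real j + 1) / (real j + 2))
        \<le> ncf_rem \<gamma> i * (of_int (ncf_quot \<gamma> i) - ncf_rem \<gamma> (Suc i))"
      using IH quot_ge_2[of i]
      by (intro mult_left_mono diff_mono) (auto simp: less_imp_le simp del: ncf_rem.simps)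
    then show ?case unfolding rem_mult by (simp add: field_simps)
  qed
  obtain j where j: "j < N" "ncf_quot \<gamma> (i + j) \<noteq> 2" using no_twos by blast
  then have "ncf_rem \<gamma> i \<le> (real j + 1) / (real j + 2)"
    using quot_ge_2[of "i + j"] by (intro aux) auto
  also have "\<dots> \<le> R" using j by (simp add: R_def field_simps)
  finally show ?thesis .
qed

lemma one_minus_rem: "1 / (real N + 1) \<le> 1 - ncf_rem \<gamma> i"
  using rem_le_R[of i] R_bounds by linarith

lemma B_ge_2: "2 \<le> B"
  using quot_ge_2[of 0] quot_le[of 0] by linarith

lemma rem_ge: "1 / of_int B \<le> ncf_rem \<gamma> i"
proof -
  have "1 / ncf_rem \<gamma> i \<le> of_int (ncf_quot \<gamma> i)"
    using rem_inverse[of i] rem_pos[of "Suc i"] by linarith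
  also have "\<dots> \<le> of_int B" using quot_le by simp
  finally show ?thesis using B_ge_2 by (simp add: field_simps)
qed

lemma D_decay: "ncf_D \<gamma> (i + n) \<le> R ^ n * ncf_D \<gamma> i"
proof (induction n)
  case (Suc n)
  have "ncf_D \<gamma> (i + n) * ncf_rem \<gamma> (i + n) \<le> (R ^ n * ncf_D \<gamma> i) * R"
    using Suc rem_le_R R_bounds by (intro mult_mono) (auto simp: less_imp_le)
  then show ?case by (simp add: D_Suc mult_ac)
qed simp

lemma dav_sums:
  assumes "0 \<le> x" "x < 1"
  shows "(\<lambda>k. of_int (dav_digit \<gamma> x k) * ncf_D \<gamma> (Suc k)) sums x"
proof -
  have "(\<lambda>i. ncf_D \<gamma> i * dav_rem \<gamma> x i) \<longlonglongrightarrow> 0"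
  proof (rule tendsto_0_le[where K = 1])
    show "(\<lambda>i. R ^ i) \<longlonglongrightarrow> 0" using R_bounds by (intro LIMSEQ_realpow_zero) auto
    have "norm (ncf_D \<gamma> i * dav_rem \<gamma> x i) \<le> R ^ i" for i
    proof -
      have "ncf_D \<gamma> i * dav_rem \<gamma> x i \<le> R ^ i * 1"
        using D_decay[of 0 i] dav_rem_bounds[OF assms, of i] R_bounds
        by (intro mult_mono) auto
      then show ?thesis using dav_rem_bounds[OF assms, of i] by (simp add: abs_mult less_imp_le)
    qed
    then show "\<forall>\<^sub>F i in sequentially. norm (ncf_D \<gamma> i * dav_rem \<gamma> x i) \<le> norm (R ^ i) * 1"
      using R_bounds by simp
  qed
  then have "(\<lambda>i. x - ncf_D \<gamma> i * dav_rem \<gamma> x i) \<longlonglongrightarrow> x - 0"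
    by (intro tendsto_diff tendsto_const)
  moreover have "x - ncf_D \<gamma> i * dav_rem \<gamma> x i = dav_base x i" for i
    using dav_expansion[of x i] by linarith
  ultimately show ?thesis by (simp add: sums_def dav_base_def)
qed

section \<open>Excluded words: clusters, separation, distance from 0 and 1\<close>

text \<open>The word takes the position \<open>i\<close> as an argument because two of the three
  excluded patterns depend on the quotients found there.\<close>

definition word_set :: "nat \<Rightarrow> (nat \<Rightarrow> nat \<Rightarrow> int) \<Rightarrow> nat \<Rightarrow> real set" where
  "word_set s w i = {x. 0 \<le> x \<and> x < 1 \<and> (\<forall>j\<le>s. dav_digit \<gamma> x (i + j) = w i j)}"

definition zero_word :: "nat \<Rightarrow> nat \<Rightarrow> int" where
  "zero_word i j = 0"

definition F_word :: "nat \<Rightarrow> nat \<Rightarrow> int" where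
  "F_word i j = (if j = 0 then ncf_quot \<gamma> i - 1 else ncf_quot \<gamma> (i + j) - 2)"

definition E_word :: "nat \<Rightarrow> nat \<Rightarrow> nat \<Rightarrow> int" where
  "E_word s i j = (if j < s then ncf_quot \<gamma> (i + j) - 2 else ncf_quot \<gamma> (i + j) - 1)"

lemma word_set_close:
  assumes "x \<in> word_set s w i" "y \<in> word_set s w i"
  shows "\<bar>dav_rem \<gamma> x i - dav_rem \<gamma> y i\<bar> \<le> R ^ Suc s"
  using assms by (intro word_contraction rem_le_R) (auto simp: word_set_def less_Suc_eq_le)

text \<open>With equal bases, \<open>word_set_close\<close> gives the bound. Different bases are at
  least \<open>1 / (N + 1)\<close> apart in units of \<open>ncf_D \<gamma> i\<close>; the remainders
  make up at most half of this, so \<open>near\<close> fails because 1/3 + 1/2 < 1.\<close>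

lemma word_set_separated:
  assumes x: "x \<in> word_set s w i" and y: "y \<in> word_set s w i"
    and s: "R ^ Suc s \<le> 1 / (2 * (real N + 1))"
    and near: "\<bar>x - y\<bar> \<le> 1 / (3 * (real N + 1)) * ncf_D \<gamma> i"
  shows "\<bar>x - y\<bar> \<le> R ^ Suc s * ncf_D \<gamma> i"
proof -
  let ?D = "ncf_D \<gamma> i"
  have x01: "0 \<le> x" "x < 1" and y01: "0 \<le> y" "y < 1" using x y by (auto simp: word_set_def)
  let ?e = "dav_rem \<gamma> x i - dav_rem \<gamma> y i"
  have eq: "x - y = (dav_base x i - dav_base y i) + ?D * ?e"
    using dav_expansion[of x i] dav_expansion[of y i] by (simp add: algebra_simps)
  have e: "\<bar>?D * ?e\<bar> \<le> R ^ Suc s * ?D"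
    using mult_left_mono[OF word_set_close[OF x y], of ?D]
    by (simp add: abs_mult less_imp_le mult.commute del: power_Suc)
  have third_half: "1 / (3 * n) + 1 / (2 * n) < 1 / n" if "0 < n" for n :: real
    using that by (simp add: field_simps)
  show ?thesis
  proof (cases "dav_base x i = dav_base y i")
    case True
    then show ?thesis using eq e by simp
  next
    case False
    have "1 / (real N + 1) * ?D \<le> ?D * (1 - ncf_rem \<gamma> i)"
      using mult_left_mono[OF one_minus_rem[of i], of ?D] by (simp add: less_imp_le)
    also have "\<dots> \<le> \<bar>dav_base x i - dav_base y i\<bar>"
      by (rule base_gap[OF x01 y01 False])
    also have "\<dots> \<le> \<bar>x - y\<bar> + \<bar>?D * ?e\<bar>" using eq by linarith
    also have "\<dots> \<le> 1 / (3 * (real N + 1)) * ?D + 1 / (2 * (real N + 1)) * ?D"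
      using near e mult_right_mono[OF s, of ?D] by (simp add: less_imp_le del: power_Suc)
    also have "\<dots> = (1 / (3 * (real N + 1)) + 1 / (2 * (real N + 1))) * ?D"
      by (simp only: distrib_right)
    also have "\<dots> < 1 / (real N + 1) * ?D"
    proof (rule mult_strict_right_mono)
      show "1 / (3 * (real N + 1)) + 1 / (2 * (real N + 1)) < 1 / (real N + 1)"
        using third_half[of "real N + 1"] by simp
    qed simp
    finally show ?thesis by simp
  qed
qed

text \<open>
  A word occurring at position $i$ keeps $x$ at distance \<open>edge * ncf_D \<gamma> i\<close> from both ends of $[0,1]$,
  except for points within $R^{s+1}$ of such an end.
\<close>

definition edge :: real where "edge = 1 / (2 * of_int B * (real N + 1))"

lemma edge_bounds: "0 < edge" "edge \<le> 1 / (2 * (real N + 1))" "edge \<le> 1 / of_int B * (1 / (real N + 1))"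
proof -
  have B: "1 \<le> real_of_int B" using B_ge_2 by simp
  then show "0 < edge" by (simp add: edge_def)
  have "edge = 1 / of_int B * (1 / (2 * (real N + 1)))" by (simp add: edge_def)
  also have "\<dots> \<le> 1 * (1 / (2 * (real N + 1)))" using B by (intro mult_right_mono) auto
  finally show "edge \<le> 1 / (2 * (real N + 1))" by simp
  have "edge \<le> 2 * edge" using \<open>0 < edge\<close> by simp
  also have "\<dots> = 1 / of_int B * (1 / (real N + 1))" by (simp add: edge_def)
  finally show "edge \<le> 1 / of_int B * (1 / (real N + 1))" .
qed

text \<open>A nonzero digit before \<open>i\<close> already contributes at least
  \<open>ncf_D \<gamma> i\<close>; otherwise only the tiny remainder is left. At the upper end, the
  zeros keep \<open>x\<close> in the lower half of a cylinder of length at least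
  \<open>ncf_D \<gamma> i / (N + 1)\<close>.\<close>

lemma zero_word_edges:
  assumes x: "x \<in> word_set s zero_word i" and s: "R ^ Suc s \<le> 1 / (2 * (real N + 1))"
  shows "x \<le> R ^ Suc s \<or> edge * ncf_D \<gamma> i \<le> x" and "edge * ncf_D \<gamma> i \<le> 1 - x"
proof -
  let ?D = "ncf_D \<gamma> i"
  have x01: "0 \<le> x" "x < 1" using x by (auto simp: word_set_def)
  \<comment> \<open>The number 0 carries the zero word at every position and is the point that
    \<open>x\<close> is compared with.\<close>
  have dz: "dav_rem \<gamma> 0 k = 0" for k by (induction k) auto
  then have "0 \<in> word_set s zero_word i"
    by (simp add: word_set_def zero_word_def dav_digit_def)
  from word_set_close[OF x this] have xi: "dav_rem \<gamma> x i \<le> R ^ Suc s" using dz by simp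
  have xs: "x \<le> dav_base x i + ?D * R ^ Suc s"
    using dav_expansion[of x i] mult_left_mono[OF xi less_imp_le[OF D_pos], of i] by linarith
  have halves: "d * (1 / n) = d * (1 / (2 * n)) + 1 / (2 * n) * d" if "0 < n" for d n :: real
    using that by (simp add: field_simps)
  have D1: "?D \<le> 1" using D_antimono[of 0 i] by simp
  show "x \<le> R ^ Suc s \<or> edge * ?D \<le> x"
  proof (cases "\<exists>k<i. dav_digit \<gamma> x k \<noteq> 0")
    case True
    then obtain k where k: "k < i" "dav_digit \<gamma> x k \<noteq> 0" by blast
    then have dk: "1 \<le> dav_digit \<gamma> x k" using dav_digit_nonneg[OF x01, of k] by linarith
    have "edge * ?D \<le> 1 * ?D"
      using order_trans[OF edge_bounds(2), of 1] by (intro mult_right_mono) (auto simp: less_imp_le)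
    also have "\<dots> \<le> 1 * ncf_D \<gamma> (Suc k)" using k D_antimono[of "Suc k" i] by simp
    also have "\<dots> \<le> of_int (dav_digit \<gamma> x k) * ncf_D \<gamma> (Suc k)"
      using dk by (intro mult_right_mono) (auto simp: less_imp_le)
    also have "\<dots> \<le> dav_base x (Suc k)" using dav_base_mono[OF x01, of 0 k] by simp
    also have "\<dots> \<le> dav_base x i" using k by (intro dav_base_mono x01) auto
    also have "\<dots> \<le> x"
      using dav_expansion[of x i] dav_rem_bounds[OF x01, of i] by (smt (verit) D_pos mult_nonneg_nonneg)
    finally show ?thesis by simp
  next
    case False
    then have "dav_base x i = 0" by (simp add: dav_base_def)
    moreover have "?D * R ^ Suc s \<le> 1 * R ^ Suc s"
      using D1 R_bounds by (intro mult_right_mono) auto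
    ultimately show ?thesis using xs by simp
  qed
  have "dav_base x i + ?D * (1 - ncf_rem \<gamma> i) \<le> 1"
    by (rule cylinder_bound_weak[OF x01, of 0]) auto
  moreover have "?D * (1 / (real N + 1)) \<le> ?D * (1 - ncf_rem \<gamma> i)"
    using one_minus_rem by (intro mult_left_mono) (auto simp: less_imp_le)
  moreover have "?D * R ^ Suc s \<le> ?D * (1 / (2 * (real N + 1)))"
    using s by (intro mult_left_mono) (auto simp: less_imp_le)
  moreover have "edge * ?D \<le> 1 / (2 * (real N + 1)) * ?D"
    using edge_bounds by (intro mult_right_mono) (auto simp: less_imp_le)
  moreover have "?D * (1 / (real N + 1)) = ?D * (1 / (2 * (real N + 1))) + 1 / (2 * (real N + 1)) * ?D"
    using halves[of "real N + 1"] by simp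
  ultimately show "edge * ?D \<le> 1 - x" using xs by linarith
qed

lemma upper_part_edge:
  assumes "0 \<le> x" "x < 1" and "1 - ncf_rem \<gamma> i \<le> dav_rem \<gamma> x i"
  shows "edge * ncf_D \<gamma> i \<le> x"
proof -
  have "edge \<le> 1 / (real N + 1)"
    using edge_bounds(2) by (rule order_trans) (simp add: field_simps)
  then have "edge * ncf_D \<gamma> i \<le> dav_rem \<gamma> x i * ncf_D \<gamma> i"
    using one_minus_rem[of i] assms(3) by (intro mult_right_mono) (auto simp: less_imp_le)
  also have "\<dots> \<le> x"
    using dav_expansion[of x i] dav_base_mono[OF assms(1,2), of 0 i] by (simp add: mult.commute)
  finally show ?thesis .
qed

text \<open>The leading digit \<open>g - 1\<close> excludes a restricted remainder, so
  \<open>x\<close> lies high in its cylinder. For \<open>i > 0\<close>,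
  \<open>full_cylinder_gap\<close> leaves room above that cylinder; for \<open>i = 0\<close> the
  word starts the digits of 1, so \<open>x\<close> is close to 1.\<close>

lemma F_word_edges:
  assumes x: "x \<in> word_set s F_word i"
  shows "edge * ncf_D \<gamma> i \<le> x" and "1 - x \<le> R ^ Suc s \<or> edge * ncf_D \<gamma> i \<le> 1 - x"
proof -
  let ?D = "ncf_D \<gamma> i"
  have x01: "0 \<le> x" "x < 1" using x by (auto simp: word_set_def)
  have dig: "dav_digit \<gamma> x i = ncf_quot \<gamma> i - 1"
    "\<And>j. 1 \<le> j \<Longrightarrow> j \<le> s \<Longrightarrow> dav_digit \<gamma> x (i + j) = ncf_quot \<gamma> (i + j) - 2"
    using x by (auto simp: word_set_def F_word_def dest!: spec[of _ 0])
  have up: "1 - ncf_rem \<gamma> i \<le> dav_rem \<gamma> x i"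
    using restricted_digit[OF x01, of i] dig(1) by linarith
  then show "edge * ?D \<le> x" by (rule upper_part_edge[OF x01])
  show "1 - x \<le> R ^ Suc s \<or> edge * ?D \<le> 1 - x"
  proof (cases "i = 0")
    case True
    \<comment> \<open>Here \<open>1 - ncf_rem \<gamma> (Suc j)\<close> is the remainder of the
      number 1 after \<open>Suc j\<close> digits, all shared with \<open>x\<close>.\<close>
    have "1 - x = ncf_D \<gamma> (Suc j) * (1 - ncf_rem \<gamma> (Suc j) - dav_rem \<gamma> x (Suc j))" if "j \<le> s" for j
      using that
    proof (induction j)
      case 0
      have "x = ncf_rem \<gamma> 0 * (of_int (ncf_quot \<gamma> 0) - 1 + dav_rem \<gamma> x (Suc 0))"
        using dav_rem_step[of x 0] dig(1) True by simp
      then show ?case using rem_mult[of 0]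
        by (simp add: D_Suc algebra_simps del: dav_rem.simps(2) ncf_rem.simps(2))
    next
      case (Suc j)
      have "dav_rem \<gamma> x (Suc j) = ncf_rem \<gamma> (Suc j) *
          (of_int (ncf_quot \<gamma> (Suc j)) - 2 + dav_rem \<gamma> x (Suc (Suc j)))"
        using dav_rem_step[of x "Suc j"] dig(2)[of "Suc j"] Suc.prems True by (simp del: dav_rem.simps)
      then have "1 - ncf_rem \<gamma> (Suc j) - dav_rem \<gamma> x (Suc j)
          = ncf_rem \<gamma> (Suc j) * (1 - ncf_rem \<gamma> (Suc (Suc j)) - dav_rem \<gamma> x (Suc (Suc j)))"
        using rem_mult[of "Suc j"] by (simp add: algebra_simps del: dav_rem.simps ncf_rem.simps)
      then show ?case using Suc by (simp add: D_Suc del: dav_rem.simps ncf_rem.simps)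
    qed
    then have "1 - x = ncf_D \<gamma> (Suc s) * (1 - ncf_rem \<gamma> (Suc s) - dav_rem \<gamma> x (Suc s))" by blast
    also have "\<dots> \<le> ncf_D \<gamma> (Suc s) * 1"
      using rem_pos[of "Suc s"] dav_rem_bounds(1)[OF x01, of "Suc s"] less_imp_le[OF D_pos, of "Suc s"]
      by (intro mult_left_mono; linarith)
    also have "\<dots> \<le> R ^ Suc s" using D_decay[of 0 "Suc s"] by simp
    finally show ?thesis by simp
  next
    case False
    have "dav_base x i + ?D + ?D * (1 - ncf_rem \<gamma> i) \<le> 1"
      using full_cylinder_gap[OF x01 up] False by simp
    moreover have "x \<le> dav_base x i + ?D"
      using dav_expansion[of x i] dav_rem_bounds[OF x01, of i]
      by (smt (verit) D_pos mult_left_le)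
    moreover have "edge * ?D \<le> ?D * (1 - ncf_rem \<gamma> i)"
    proof -
      have "edge \<le> 1 - ncf_rem \<gamma> i"
        using edge_bounds(2) one_minus_rem[of i] by (smt (verit) divide_left_mono of_nat_0_le_iff zero_less_mult_iff)
      then show ?thesis by (simp add: mult.commute mult_left_mono less_imp_le)
    qed
    ultimately show ?thesis by linarith
  qed
qed

text \<open>A restricted remainder would persist through the digits \<open>g - 2\<close> and forbid
  the final \<open>g - 1\<close>. So the cylinder is full and ends by 1. Its first digit is
  \<open>g - 2\<close>, as \<open>s\<close> is positive, which keeps \<open>x\<close> below the top
  by a fraction of at least \<open>1 / (B * (N + 1))\<close>.\<close>

lemma E_word_edges:
  assumes x: "x \<in> word_set s (E_word s) i" and s: "1 \<le> s"
  shows "edge * ncf_D \<gamma> i \<le> x" and "edge * ncf_D \<gamma> i \<le> 1 - x"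
proof -
  let ?D = "ncf_D \<gamma> i"
  have x01: "0 \<le> x" "x < 1" using x by (auto simp: word_set_def)
  have dig: "\<forall>j<s. dav_digit \<gamma> x (i + j) = ncf_quot \<gamma> (i + j) - 2"
    "dav_digit \<gamma> x (i + s) = ncf_quot \<gamma> (i + s) - 1"
    using x by (auto simp: word_set_def E_word_def)
  have up: "1 - ncf_rem \<gamma> i \<le> dav_rem \<gamma> x i"
  proof (rule ccontr)
    assume "\<not> ?thesis"
    then have "dav_rem \<gamma> x (i + s) < 1 - ncf_rem \<gamma> (i + s)"
      using dig(1) by (intro restricted_persists x01) auto
    from restricted_digit[OF x01 this] show False using dig(2) by simp
  qed
  then show "edge * ?D \<le> x" by (rule upper_part_edge[OF x01])
  have "dav_base x i + ?D \<le> 1"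
    using cylinder_bound[OF x01, of 0 1 i] up by auto
  moreover have "edge * ?D \<le> ?D * (1 - dav_rem \<gamma> x i)"
  proof -
    have "dav_rem \<gamma> x i = ncf_rem \<gamma> i * (of_int (ncf_quot \<gamma> i) - 2 + dav_rem \<gamma> x (Suc i))"
      using dav_rem_step[of x i] dig(1)[rule_format, of 0] s by (simp del: dav_rem.simps)
    then have "1 - dav_rem \<gamma> x i
        = ncf_rem \<gamma> i * (1 - ncf_rem \<gamma> (Suc i)) + ncf_rem \<gamma> i * (1 - dav_rem \<gamma> x (Suc i))"
      using rem_mult[of i] by (simp add: algebra_simps del: dav_rem.simps ncf_rem.simps)
    moreover have "0 \<le> ncf_rem \<gamma> i * (1 - dav_rem \<gamma> x (Suc i))"
      using dav_rem_bounds[OF x01, of "Suc i"] by (simp add: less_imp_le del: dav_rem.simps)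
    moreover have "1 / of_int B * (1 / (real N + 1)) \<le> ncf_rem \<gamma> i * (1 - ncf_rem \<gamma> (Suc i))"
      using rem_ge[of i] one_minus_rem[of "Suc i"] by (intro mult_mono) (auto simp: less_imp_le simp del: ncf_rem.simps)
    ultimately have "edge \<le> 1 - dav_rem \<gamma> x i" using edge_bounds(3) by linarith
    then show ?thesis by (simp add: mult.commute mult_left_mono less_imp_le)
  qed
  ultimately show "edge * ?D \<le> 1 - x"
    using dav_expansion[of x i] by (simp add: algebra_simps)
qed

section \<open>Counting scales and criteria for membership\<close>

text \<open>The products decrease, and \<open>m\<close> places after first falling below
  \<open>e\<close> they are below \<open>R ^ m * e\<close>.\<close>

lemma few_scales:
  assumes "0 < e"
  shows "finite {n. R ^ m * e \<le> ncf_D \<gamma> n \<and> ncf_D \<gamma> n < e}"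
    and "card {n. R ^ m * e \<le> ncf_D \<gamma> n \<and> ncf_D \<gamma> n < e} \<le> m"
proof -
  let ?S = "{n. R ^ m * e \<le> ncf_D \<gamma> n \<and> ncf_D \<gamma> n < e}"
  define k where "k = (LEAST n. ncf_D \<gamma> n < e)"
  have "?S \<subseteq> {k..<k + m}"
  proof
    fix n assume n: "n \<in> ?S"
    then have kn: "k \<le> n" unfolding k_def by (auto intro: Least_le)
    have "ncf_D \<gamma> k < e" unfolding k_def by (rule LeastI[of _ n]) (use n in auto)
    then have "R ^ m * ncf_D \<gamma> k < R ^ m * e" using R_bounds by simp
    then have "ncf_D \<gamma> (k + m) < ncf_D \<gamma> n" using D_decay[of k m] n by auto
    then have "n < k + m" using D_antimono[of "k + m" n] by (meson not_less)
    then show "n \<in> {k..<k + m}" using kn by simp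
  qed
  then show "finite ?S" "card ?S \<le> m"
    using finite_subset[of ?S] card_mono[of "{k..<k + m}" ?S] by auto
qed

lemma E_set_memI:
  assumes "0 \<le> x" "x < 1" and "\<And>i. x \<notin> word_set s zero_word i" "\<And>i. x \<notin> word_set s (E_word s) i"
  shows "x \<in> E_set \<gamma> s"
proof -
  have "\<not> has_zero_block s (dav_digit \<gamma> x)"
    using assms by (auto simp: has_zero_block_def word_set_def zero_word_def)
  moreover have "\<not> has_E_block \<gamma> s (dav_digit \<gamma> x)"
  proof
    assume "has_E_block \<gamma> s (dav_digit \<gamma> x)"
    then obtain i where "\<forall>j<s. dav_digit \<gamma> x (i + j) = ncf_quot \<gamma> (i + j) - 2"
      "dav_digit \<gamma> x (i + s) = ncf_quot \<gamma> (i + s) - 1"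
      by (auto simp: has_E_block_def)
    then have "x \<in> word_set s (E_word s) i"
      using assms(1,2) by (auto simp: word_set_def E_word_def dest: le_neq_implies_less)
    then show False using assms by blast
  qed
  moreover have "is_E_rep \<gamma> x (dav_digit \<gamma> x)"
    using dav_sums[OF assms(1,2)] by (simp add: is_E_rep_def)
  ultimately show ?thesis using assms(1,2) by (auto simp: E_set_def)
qed

lemma F_set_memI:
  assumes "0 \<le> x" "x < 1" and "\<And>i. x \<notin> word_set s zero_word i" "\<And>i. x \<notin> word_set s F_word i"
  shows "x \<in> F_set \<gamma> s"
proof -
  have "\<not> has_zero_block s (dav_digit \<gamma> x)"
    using assms by (auto simp: has_zero_block_def word_set_def zero_word_def)
  moreover have "\<not> has_F_block \<gamma> s (dav_digit \<gamma> x)"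
  proof
    assume "has_F_block \<gamma> s (dav_digit \<gamma> x)"
    then obtain i where "dav_digit \<gamma> x i = ncf_quot \<gamma> i - 1"
      "\<forall>j. 1 \<le> j \<and> j \<le> s \<longrightarrow> dav_digit \<gamma> x (i + j) = ncf_quot \<gamma> (i + j) - 2"
      by (auto simp: has_F_block_def)
    then have "x \<in> word_set s F_word i"
      using assms(1,2) by (auto simp: word_set_def F_word_def)
    then show False using assms by blast
  qed
  ultimately show ?thesis using assms(1,2) by (auto simp: F_set_def)
qed

section \<open>Writing a square as a product\<close>

text \<open>Two flags index four families of conditions: \<open>F\<close> tells which factor is
  constrained, and \<open>z\<close> selects the zero word, which is excluded for both.\<close>

definition bad_word :: "nat \<Rightarrow> bool \<Rightarrow> bool \<Rightarrow> nat \<Rightarrow> nat \<Rightarrow> int" where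
  "bad_word s F z = (if z then zero_word else if F then F_word else E_word s)"

text \<open>With \<open>\<rho> = min r (1 - r)\<close>, the distance of \<open>z\<close> from
  \<open>r\<close> is below \<open>\<rho> * (1 - R)\<close>, so \<open>z\<close> and
  \<open>1 - z\<close> exceed \<open>R ^ Suc s\<close> and the exceptions near 0 and 1 drop out. The
  edge bounds then clash with \<open>D\<close>, since \<open>z\<close> or \<open>1 - z\<close> is
  below \<open>3 * \<rho>\<close>.\<close>

lemma coarse_words_avoided:
  assumes s: "1 \<le> s" "R ^ Suc s \<le> 1 / (2 * (real N + 1))"
    and r: "R ^ s \<le> r" "R ^ s \<le> 1 - r"
    and z: "\<bar>z - r\<bar> \<le> min r (1 - r) / (2 * (real N + 1))"
    and D: "3 * min r (1 - r) \<le> edge * ncf_D \<gamma> i"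
  shows "z \<notin> word_set s (bad_word s F zr) i"
proof
  assume bad: "z \<in> word_set s (bad_word s F zr) i"
  let ?\<rho> = "min r (1 - r)"
  have Rs: "0 < R ^ s" using R_bounds by simp
  have \<rho>: "R ^ s \<le> ?\<rho>" using r by simp
  have half: "1 / (2 * (real N + 1)) < 1 - R"
    using R_bounds(3) by (simp add: field_simps)
  have "?\<rho> * (1 / (2 * (real N + 1))) < ?\<rho> * (1 - R)"
    using half \<rho> Rs by (intro mult_strict_left_mono) auto
  then have z': "\<bar>z - r\<bar> < ?\<rho> * (1 - R)" using z by simp
  have "R ^ Suc s \<le> ?\<rho> * R" using \<rho> R_bounds by (simp add: mult.commute)
  moreover have "?\<rho> * (1 - R) = ?\<rho> - ?\<rho> * R" by (simp only: right_diff_distrib mult_1_right)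
  ultimately have "R ^ Suc s < ?\<rho> - \<bar>z - r\<bar>" using z' by linarith
  then have far: "R ^ Suc s < z" "R ^ Suc s < 1 - z" by linarith+
  have "?\<rho> * (1 - R) \<le> ?\<rho> * 1"
    using R_bounds less_imp_le[OF less_le_trans[OF Rs \<rho>]] by (intro mult_left_mono) auto
  from less_le_trans[OF z' this] have "\<bar>z - r\<bar> < ?\<rho>" by simp
  then have near: "z < 3 * ?\<rho> \<or> 1 - z < 3 * ?\<rho>"
    by (cases "r \<le> 1 - r") auto
  have "edge * ncf_D \<gamma> i \<le> z \<and> edge * ncf_D \<gamma> i \<le> 1 - z"
    using bad far zero_word_edges[OF _ s(2), of z i] F_word_edges[of z s i] E_word_edges[of z s i, OF _ s(1)]
    by (auto simp: bad_word_def simp del: power_Suc split: if_splits)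
  then show False using near D by linarith
qed

text \<open>The factors are \<open>x\<close> slightly above \<open>r\<close> and
  \<open>r^2 / x\<close>. Conditions on the second factor are pulled back to \<open>x\<close>, so
  one application of \<open>multiscale_avoidance\<close> handles both.\<close>

lemma square_is_product:
  assumes s: "1 \<le> s" and m: "1 \<le> m" "(4 * real m + 1) * R ^ m \<le> 1 / 2"
    and \<kappa>: "0 < \<kappa>" "\<kappa> \<le> 1 / (3 * (real N + 1)) * R ^ m" "\<kappa> \<le> edge / (6 * (real N + 1))"
    and small: "32 * real m * R ^ Suc s < \<kappa>"
    and r: "R ^ s \<le> r" "R ^ s \<le> 1 - r"
  shows "\<exists>x\<in>E_set \<gamma> s. \<exists>y\<in>F_set \<gamma> s. x * y = r\<^sup>2"
proof -
  let ?\<rho> = "min r (1 - r)" and ?c = "1 / (3 * (real N + 1))" and ?\<delta> = "4 * R ^ Suc s"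
  \<comment> \<open>Scales from \<open>a\<close> on are those covered by
    \<open>coarse_words_avoided\<close>. The bound \<open>edge / (6 * (N + 1))\<close> on
    \<open>\<kappa>\<close> makes the first window short enough for that lemma.\<close>
  define a where "a = 3 * ?\<rho> / edge"
  have Rs: "0 < R ^ s" "0 < R ^ Suc s" "0 < R ^ m" "R ^ m \<le> 1"
    using R_bounds by (auto intro: power_le_one simp del: power_Suc)
  have \<rho>: "R ^ s \<le> ?\<rho>" "0 < ?\<rho>" using r Rs by auto
  have r01: "0 < r" "r < 1" using r Rs by linarith+
  have a: "0 < a" using \<rho> edge_bounds by (simp add: a_def)
  have "1 * R ^ Suc s \<le> 32 * real m * R ^ Suc s" using m Rs by (intro mult_right_mono) auto
  also have "\<dots> \<le> ?c * R ^ m" using small \<kappa> by linarith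
  also have "\<dots> \<le> ?c * 1" using Rs by (intro mult_left_mono) auto
  also have "\<dots> \<le> 1 / (2 * (real N + 1))" by (simp add: field_simps)
  finally have s2: "R ^ Suc s \<le> 1 / (2 * (real N + 1))" by simp
  define h where "h = ?\<rho> / (2 * (real N + 1))"
  have "h < ?\<rho> / 1" unfolding h_def using \<rho> by (intro divide_strict_left_mono) auto
  then have h: "0 < h" "h < ?\<rho>" using \<rho> by (auto simp: h_def)
  have "\<kappa> * a \<le> edge / (6 * (real N + 1)) * a" using \<kappa> a by (intro mult_right_mono) auto
  also have "edge / (6 * (real N + 1)) * a = h"
  proof -
    have "e / (6 * n) * (3 * p / e) = p / (2 * n)" if "0 < e" "0 < n" for e n p :: real
      using that by (simp add: field_simps)
    from this[of edge "real N + 1"] show ?thesis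
      unfolding a_def h_def using edge_bounds(1) by simp
  qed
  finally have width: "\<kappa> * a \<le> h" .
  have y_near: "\<bar>r\<^sup>2 / x - r\<bar> \<le> h" "0 < r\<^sup>2 / x" if "x \<in> {r..r + \<kappa> * a}" for x
  proof -
    have x: "r \<le> x" "x \<le> r + h" using that width by auto
    have "r\<^sup>2 / x \<le> r" using x r01 by (simp add: field_simps power2_eq_square)
    moreover have "r - r\<^sup>2 / x \<le> x - r"
    proof -
      have "r - r\<^sup>2 / x = r / x * (x - r)"
        using x r01 by (simp add: field_simps power2_eq_square)
      also have "\<dots> \<le> 1 * (x - r)"
        using x r01 by (intro mult_right_mono) auto
      finally show ?thesis by simp
    qed
    ultimately show "\<bar>r\<^sup>2 / x - r\<bar> \<le> h" using x by linarith
    show "0 < r\<^sup>2 / x" using x r01 by simp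
  qed
  define arg where "arg F x = (if F then r\<^sup>2 / x else x)" for F and x :: real
  define Bad where "Bad p = (case p of ((F, z), i) \<Rightarrow> {x. arg F x \<in> word_set s (bad_word s F z) i})" for p
  have arg_near: "\<bar>arg F x - r\<bar> \<le> h" if "x \<in> {r..r + \<kappa> * a}" for F x
    using y_near[OF that] that width by (auto simp: arg_def)
  have arg_dist: "\<bar>arg F x - arg F y\<bar> \<le> \<bar>x - y\<bar> \<and> \<bar>x - y\<bar> \<le> 4 * \<bar>arg F x - arg F y\<bar>"
    if x: "x \<in> {r..r + \<kappa> * a}" and y: "y \<in> {r..r + \<kappa> * a}" for F x y
  proof (cases F)
    case True
    \<comment> \<open>Both points lie between \<open>r\<close> and \<open>2 * r\<close>, so the
      difference quotient of \<open>u \<mapsto> r^2 / u\<close> has absolute value between 1/4 and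
      1.\<close>
    have "r \<le> x" "r \<le> y" "x \<le> 2 * r" "y \<le> 2 * r" using x y width h by auto
    then have "r * r \<le> x * y" "x * y \<le> (2 * r) * (2 * r)"
      using r01 by (intro mult_mono; linarith)+
    moreover have "0 < x * y" using \<open>r \<le> x\<close> \<open>r \<le> y\<close> r01 by simp
    ultimately have q: "r\<^sup>2 / (x * y) \<le> 1" "1 \<le> 4 * (r\<^sup>2 / (x * y))"
      by (auto simp: field_simps power2_eq_square)
    have "r\<^sup>2 / x - r\<^sup>2 / y = r\<^sup>2 / (x * y) * (y - x)"
      using \<open>r \<le> x\<close> \<open>r \<le> y\<close> r01 by (simp add: field_simps)
    then have eq: "\<bar>arg F x - arg F y\<bar> = r\<^sup>2 / (x * y) * \<bar>x - y\<bar>"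
      using True \<open>r \<le> x\<close> \<open>r \<le> y\<close> r01 by (simp add: arg_def abs_mult abs_minus_commute)
    show ?thesis unfolding eq
      using mult_right_mono[OF q(1), of "\<bar>x - y\<bar>"] mult_right_mono[OF q(2), of "\<bar>x - y\<bar>"] by simp
  qed (simp add: arg_def)
  \<comment> \<open>Four families with at most \<open>m\<close> positions per stage give
    \<open>M = 4 * m\<close>. The factor 4 in \<open>\<delta>\<close> is the loss in pulling back to
    \<open>x\<close>, and \<open>32 * m * R ^ Suc s\<close> equals
    \<open>2 * M * \<delta>\<close>.\<close>
  have "\<exists>x\<in>{r..r + \<kappa> * a}. \<forall>p. x \<notin> Bad p"
  proof (rule multiscale_avoidance[where d = "\<lambda>p. ncf_D \<gamma> (snd p)" and \<theta> = "R ^ m" and M = "4 * m"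
        and c = ?c and \<delta> = ?\<delta>])
    have "R ^ m \<le> R ^ 1" using m R_bounds by (intro power_decreasing) auto
    then show "R ^ m < 1" using R_bounds by simp
    fix e :: real assume e: "0 < e"
    let ?S = "{n. R ^ m * e \<le> ncf_D \<gamma> n \<and> ncf_D \<gamma> n < e}"
    have eq: "{p :: (bool \<times> bool) \<times> nat. R ^ m * e \<le> ncf_D \<gamma> (snd p) \<and> ncf_D \<gamma> (snd p) < e} = UNIV \<times> ?S"
      by auto
    show "finite {p :: (bool \<times> bool) \<times> nat. R ^ m * e \<le> ncf_D \<gamma> (snd p) \<and> ncf_D \<gamma> (snd p) < e} \<and>
      card {p :: (bool \<times> bool) \<times> nat. R ^ m * e \<le> ncf_D \<gamma> (snd p) \<and> ncf_D \<gamma> (snd p) < e} \<le> 4 * m"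
      unfolding eq using few_scales[OF e, of m]
      by (simp add: card_cartesian_product card_UNIV_bool flip: UNIV_Times_UNIV)
  next
    fix p :: "(bool \<times> bool) \<times> nat" and x y
    assume bad: "x \<in> Bad p" "y \<in> Bad p" and x: "x \<in> {r..r + \<kappa> * a}" and y: "y \<in> {r..r + \<kappa> * a}"
      and near: "\<bar>x - y\<bar> \<le> ?c * ncf_D \<gamma> (snd p)"
    obtain F z i where p: "p = ((F, z), i)" by (metis prod.exhaust)
    have "\<bar>arg F x - arg F y\<bar> \<le> R ^ Suc s * ncf_D \<gamma> i"
      using bad near arg_dist[OF x y, of F]
      by (intro word_set_separated[OF _ _ s2]) (auto simp: Bad_def p)
    then show "\<bar>x - y\<bar> \<le> ?\<delta> * ncf_D \<gamma> (snd p)"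
      using arg_dist[OF x y, of F] by (simp add: p)
  next
    fix p :: "(bool \<times> bool) \<times> nat" assume p: "a \<le> ncf_D \<gamma> (snd p)"
    then have "3 * ?\<rho> \<le> edge * ncf_D \<gamma> (snd p)"
      using edge_bounds(1) by (simp add: a_def field_simps)
    then show "Bad p \<inter> {r..r + \<kappa> * a} = {}"
      using coarse_words_avoided[OF s s2 r] arg_near
      by (force simp: Bad_def h_def split: prod.splits)
  qed (use a \<kappa> m small Rs in \<open>auto simp: mult_ac simp del: power_Suc\<close>)
  then obtain x where x: "x \<in> {r..r + \<kappa> * a}" and good: "\<And>p. x \<notin> Bad p" by blast
  have arg01: "0 \<le> arg F x" "arg F x < 1" for F
    using arg_near[OF x, of F] h by auto
  have avoid: "arg F x \<notin> word_set s (bad_word s F z) i" for F z i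
    using good[of "((F, z), i)"] by (simp add: Bad_def)
  have "arg False x \<in> E_set \<gamma> s"
    using avoid[of False True] avoid[of False False] arg01 by (intro E_set_memI) (auto simp: bad_word_def)
  moreover have "arg True x \<in> F_set \<gamma> s"
    using avoid[of True True] avoid[of True False] arg01 by (intro F_set_memI) (auto simp: bad_word_def)
  moreover have "arg False x * arg True x = r\<^sup>2" using x r01 by (simp add: arg_def)
  ultimately show ?thesis by blast
qed

section \<open>Choice of the constants and the range of products\<close>

lemma exists_stage_length: "\<exists>m\<ge>1. (4 * real m + 1) * R ^ m \<le> 1 / 2"
proof -
  have "(\<lambda>n. 4 * (real n * R ^ n) + R ^ n) \<longlonglongrightarrow> 4 * 0 + 0"
    using R_bounds powser_times_n_limit_0[of R]
    by (intro tendsto_add tendsto_mult tendsto_const LIMSEQ_realpow_zero) auto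
  then have "\<forall>\<^sub>F n in sequentially. 4 * (real n * R ^ n) + R ^ n < 1 / 2"
    by (intro order_tendstoD(2)) auto
  then obtain k where k: "\<And>n. k \<le> n \<Longrightarrow> 4 * (real n * R ^ n) + R ^ n < 1 / 2"
    by (auto simp: eventually_sequentially)
  then show ?thesis 
    using k[of "Suc k"] by (intro exI[of _ "Suc k"]) (simp add: algebra_simps del: power_Suc)
qed

text \<open>Bernoulli gives \<open>(1 + 1 / N) ^ N \<ge> 2\<close>, and \<open>R\<close> is the
  inverse of \<open>1 + 1 / N\<close>. This turns \<open>R ^ (s - N)\<close> into an upper bound for
  \<open>2 * R ^ s\<close>.\<close>

lemma R_power_N: "2 * R ^ N \<le> 1"
proof -
  have "1 + real N * (1 / real N) \<le> (1 + 1 / real N) ^ N"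
    by (rule Bernoulli_inequality) (simp add: order_trans[of _ 0])
  then have "2 * R ^ N \<le> (1 + 1 / real N) ^ N * R ^ N"
    using N_pos R_bounds by (intro mult_right_mono) auto
  also have "(1 + 1 / real N) ^ N * R ^ N = ((1 + 1 / real N) * R) ^ N"
    by (simp only: power_mult_distrib)
  also have "(1 + 1 / real N) * R = 1"
    using N_pos by (simp add: R_def divide_simps)
  finally show ?thesis by simp
qed

end

theorem theorem6p11:
  fixes \<gamma> :: real and N :: nat
  assumes "0 < \<gamma>" and "\<gamma> < 1" and "\<gamma> \<notin> \<rat>"
    and "\<exists>B. \<forall>i. \<bar>ncf_quot \<gamma> i\<bar> \<le> B"
    and "N \<ge> 1"
    and "\<not> (\<exists>i. \<forall>j<N. ncf_quot \<gamma> (i + j) = 2)"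
  shows "\<exists>s0\<ge>N. \<forall>s\<ge>s0.
    (let R = real N / (real N + 1);
         P1 = R ^ (2 * s) / (1 - R ^ (s - N))\<^sup>2;
         P2 = 1 - R ^ (s - N)
     in P2 \<ge> P1 \<and> {P1..P2} \<subseteq> {x * y | x y. x \<in> E_set \<gamma> s \<and> y \<in> F_set \<gamma> s})"
proof -
  obtain B where B: "\<And>i. \<bar>ncf_quot \<gamma> i\<bar> \<le> B" using assms(4) by blast
  define R where "R = real N / (real N + 1)"
  interpret negative_cf_bounded \<gamma> N B R
    using assms B by unfold_locales (auto simp: R_def abs_le_iff)
  obtain m where m: "1 \<le> m" "(4 * real m + 1) * R ^ m \<le> 1 / 2"
    using exists_stage_length by blast
  \<comment> \<open>The largest value allowed by \<open>square_is_product\<close>; it depends on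
    neither \<open>s\<close> nor the product sought.\<close>
  define \<kappa> where "\<kappa> = min (1 / (3 * (real N + 1)) * R ^ m) (edge / (6 * (real N + 1)))"
  have \<kappa>: "0 < \<kappa>" using R_bounds edge_bounds by (simp add: \<kappa>_def)
  have "(\<lambda>n. 32 * real m * R ^ n) \<longlonglongrightarrow> 32 * real m * 0"
    using R_bounds by (intro tendsto_mult tendsto_const LIMSEQ_realpow_zero) auto
  then have "\<forall>\<^sub>F n in sequentially. 32 * real m * R ^ n < \<kappa>"
    using \<kappa> by (intro order_tendstoD(2)[where a = \<kappa>]) auto
  moreover have "\<forall>\<^sub>F n in sequentially. R ^ n < 1 / 4"
    using R_bounds by (intro order_tendstoD(2)[OF LIMSEQ_realpow_zero]) auto
  ultimately have "\<forall>\<^sub>F n in sequentially. 32 * real m * R ^ n < \<kappa> \<and> R ^ n < 1 / 4"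
    by (rule eventually_conj)
  then obtain k where k: "\<And>n. k \<le> n \<Longrightarrow> 32 * real m * R ^ n < \<kappa> \<and> R ^ n < 1 / 4"
    unfolding eventually_sequentially by blast
  have main: "P1 \<le> P2 \<and> {P1..P2} \<subseteq> {x * y | x y. x \<in> E_set \<gamma> s \<and> y \<in> F_set \<gamma> s}"
    if s: "N + k \<le> s" and P1: "P1 = R ^ (2 * s) / (1 - R ^ (s - N))\<^sup>2" and P2: "P2 = 1 - R ^ (s - N)"
    for s P1 P2
  proof -
    let ?q = "R ^ (s - N)"
    have q: "0 < ?q" "?q < 1 / 4" using k[of "s - N"] s R_bounds by auto
    have "R ^ s = ?q * R ^ N" using s by (simp flip: power_add)
    then have Rs: "2 * R ^ s \<le> ?q" using mult_left_mono[OF R_power_N, of ?q] q by simp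
    have Rs0: "0 < R ^ s" using R_bounds by simp
    have sq: "R ^ (2 * s) = (R ^ s)\<^sup>2" by (simp add: power_even_eq)
    \<comment> \<open>From \<open>2 * R ^ s \<le> ?q < 1 / 4\<close> the numerator is at most 1/8
      and the denominator at least 3/4. Hence \<open>P1 \<le> 1 / 36\<close>, while
      \<open>P2 > 3 / 4\<close>.\<close>
    have "R ^ s / (1 - ?q) \<le> (1 / 8) / (3 / 4)"
      using q Rs Rs0 by (intro frac_le) auto
    then have "(R ^ s / (1 - ?q))\<^sup>2 \<le> (1 / 6)\<^sup>2"
      using q Rs0 by (intro power_mono) auto
    then have "P1 \<le> 1 / 36" by (simp add: P1 sq power_divide)
    then have le: "P1 \<le> P2" using q by (simp add: P2)
    have "t \<in> {x * y | x y. x \<in> E_set \<gamma> s \<and> y \<in> F_set \<gamma> s}" if t: "t \<in> {P1..P2}" for t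
    proof -
      \<comment> \<open>The rest shows that \<open>r = sqrt t\<close> has distance at least
        \<open>R ^ s\<close> from 0 and from 1, as \<open>square_is_product\<close>
        requires.\<close>
      have "(R ^ s)\<^sup>2 / 1 \<le> P1"
        unfolding P1 sq using q by (intro divide_left_mono) (auto simp: power_le_one)
      then have t1: "(R ^ s)\<^sup>2 \<le> t" using t by simp
      then have "R ^ s \<le> sqrt t" by (rule real_le_rsqrt)
      have "t \<le> 1 - 2 * R ^ s" using t Rs by (simp add: P2)
      also have "\<dots> \<le> (1 - R ^ s)\<^sup>2" by (simp add: power2_diff)
      finally have "sqrt t \<le> 1 - R ^ s"
        using q Rs by (intro real_le_lsqrt) auto
      have "\<exists>x\<in>E_set \<gamma> s. \<exists>y\<in>F_set \<gamma> s. x * y = (sqrt t)\<^sup>2"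
      proof (rule square_is_product[OF _ m \<kappa>])
        show "1 \<le> s" using N_pos s by simp
        show "32 * real m * R ^ Suc s < \<kappa>" using k[of "Suc s"] s by simp
      qed (use \<open>R ^ s \<le> sqrt t\<close> \<open>sqrt t \<le> 1 - R ^ s\<close> in \<open>auto simp: \<kappa>_def\<close>)
      moreover have "(sqrt t)\<^sup>2 = t" using order_trans[OF zero_le_power2 t1] by simp
      ultimately show ?thesis by force
    qed
    then show ?thesis using le by blast
  qed
  show ?thesis
    \<comment> \<open>The shift by \<open>N\<close> makes \<open>s - N\<close> at least
      \<open>k\<close>, so the smallness of powers of \<open>R\<close> also holds for the exponent
      \<open>s - N\<close>.\<close>
    unfolding Let_def R_def[symmetric] using main by (intro exI[of _ "N + k"]) auto
qed

end
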